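(* Let $\alpha>0$, $\alpha\ne1$, and for $\sigma>0$ let $p_0(x)=\frac{1}{\sigma\sqrt{2\pi}}e^{-x^2/(2\sigma^2)}$, $x\in\mathbb R$, be the centered Gaussian density. Put $$\mathcal H_\alpha^{(1)}(\sigma)=\frac{1}{|1-\alpha|}\left|\log\int_{\mathbb R}p_0^\alpha(x)\,dx\right|,\quad \mathcal H_\alpha^{(2)}(\sigma)=\frac{1}{|1-\alpha|}\left(\log\int_{\mathbb R}p_0^\alpha(x)\,dx\right)_+,$$ $$\mathcal H_\alpha^{(3)}(\sigma)=\frac{1}{|1-\alpha|}\log\left(\int_{\mathbb R}p_0^\alpha(x)\,dx+1\right),$$ and define $\sigma_\alpha:=(2\pi)^{-1/2}\alpha^{1/[2(1-\alpha)]}$. Then: 1) For any $\alpha\in(0,1)\cup(1,+\infty)$, $$\mathcal H_\alpha^{(1)}(\sigma)=\begin{cases}-\log\sigma-\frac12\log(2\pi)+\frac{\log\alpha}{2(1-\alpha)},&\text{if }\sigma\le\sigma_\alpha,\\ \log\sigma+\frac12\log(2\pi)-\frac{\log\alpha}{2(1-\alpha)},&\text{if }\sigma>\sigma_\alpha.\end{cases}$$ The function $\mathcal H_\alpha^{(1)}$ decreases from $+\infty$ to $0$ as $\sigma$ increases from $0$ to $\sigma_\alpha$, and increases from $0$ to $+\infty$ as $\sigma$ increases from $\sigma_\alpha$ to $+\infty$. 2) If $\alpha\in(0,1)$, then $$\mathcal H_\alpha^{(2)}(\sigma)=\begin{cases}0,&\text{if }\sigma\le\sigma_\alpha,\\ \log\sigma+\frac12\log(2\pi)-\frac{\log\alpha}{2(1-\alpha)},&\text{if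 }\sigma>\sigma_\alpha,\end{cases}$$ and $\mathcal H_\alpha^{(2)}$ increases from $0$ to $+\infty$ as $\sigma$ increases from $\sigma_\alpha$ to $+\infty$. If $\alpha>1$, then $$\mathcal H_\alpha^{(2)}(\sigma)=\begin{cases}-\log\sigma-\frac12\log(2\pi)+\frac{\log\alpha}{2(1-\alpha)},&\text{if }\sigma\le\sigma_\alpha,\\ 0,&\text{if }\sigma>\sigma_\alpha,\end{cases}$$ and $\mathcal H_\alpha^{(2)}$ decreases from $+\infty$ to $0$ as $\sigma$ increases from $0$ to $\sigma_\alpha$. 3) If $\alpha\in(0,1)$, then $\mathcal H_\alpha^{(3)}$ increases from $0$ to $+\infty$ as $\sigma$ increases from $0$ to $+\infty$. If $\alpha>1$, then $\mathcal H_\alpha^{(3)}$ decreases from $+\infty$ to $0$ as $\sigma$ increases from $0$ to $+\infty$.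
   Context: $\log$ is the natural logarithm and $a_+=\max(a,0)$. Phrases such as "decreases from $+\infty$ to $0$ as $\sigma$ increases from $0$ to $\sigma_\alpha$" mean monotonicity on the indicated interval, with the stated values being attained at, or being the limits at, the endpoints. The functionals $\mathcal H_\alpha^{(i)}$ are the alternative Rényi entropies $\mathcal H_{R,\alpha}^{(i)}$ evaluated at the density $p_0$ and regarded as functions of $\sigma$. *)

theory Defs
  imports "HOL-Probability.Probability"
begin

definition power_integral :: "real \<Rightarrow> (real \<Rightarrow> real) \<Rightarrow> real" where
  "power_integral \<alpha> p = (LINT x|lborel. p x powr \<alpha>)"

definition alt_renyi_entropy1 :: "real \<Rightarrow> (real \<Rightarrow> real) \<Rightarrow> real" where
  "alt_renyi_entropy1 \<alpha> p = 1 / \<bar>1 - \<alpha>\<bar> * \<bar>ln (power_integral \<alpha> p)\<bar>"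

definition alt_renyi_entropy2 :: "real \<Rightarrow> (real \<Rightarrow> real) \<Rightarrow> real" where
  "alt_renyi_entropy2 \<alpha> p = 1 / \<bar>1 - \<alpha>\<bar> * max (ln (power_integral \<alpha> p)) 0"

definition alt_renyi_entropy3 :: "real \<Rightarrow> (real \<Rightarrow> real) \<Rightarrow> real" where
  "alt_renyi_entropy3 \<alpha> p = 1 / \<bar>1 - \<alpha>\<bar> * ln (power_integral \<alpha> p + 1)"

abbreviation gauss_density :: "real \<Rightarrow> real \<Rightarrow> real" where
  "gauss_density \<sigma> \<equiv> normal_density 0 \<sigma>"

definition H1 :: "real \<Rightarrow> real \<Rightarrow> real" where
  "H1 \<alpha> \<sigma> = alt_renyi_entropy1 \<alpha> (gauss_density \<sigma>)"

definition H2 :: "real \<Rightarrow> real \<Rightarrow> real" where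
  "H2 \<alpha> \<sigma> = alt_renyi_entropy2 \<alpha> (gauss_density \<sigma>)"

definition H3 :: "real \<Rightarrow> real \<Rightarrow> real" where
  "H3 \<alpha> \<sigma> = alt_renyi_entropy3 \<alpha> (gauss_density \<sigma>)"

definition sigma_crit :: "real \<Rightarrow> real" where
  "sigma_crit \<alpha> = (2 * pi) powr (- 1 / 2) * \<alpha> powr (1 / (2 * (1 - \<alpha>)))"

(* The library writes the normalising factor as 1 / sqrt (2 * pi * \<sigma>\<^sup>2), which
   agrees with the usual form only for \<sigma> > 0. *)
lemma gauss_density_eq:
  assumes "\<sigma> > 0"
  shows "gauss_density \<sigma> x = 1 / (\<sigma> * sqrt (2 * pi)) * exp (- x\<^sup>2 / (2 * \<sigma>\<^sup>2))"
  using assms by (simp add: normal_density_def real_sqrt_mult)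

(* The Bochner integral and ln are total (both give 0 outside their natural domain);
   integrability and positivity, proved below,
   ensure that these default values are not used in H1, H2, H3. *)
lemma gauss_density_powr:
  assumes "\<alpha> > 0" "\<sigma> > 0"
  defines "c \<equiv> (1 / sqrt (2 * pi * \<sigma>\<^sup>2)) powr \<alpha> * sqrt (2 * pi * (\<sigma> / sqrt \<alpha>)\<^sup>2)"
  shows "c > 0" and "gauss_density \<sigma> x powr \<alpha> = c * gauss_density (\<sigma> / sqrt \<alpha>) x"
proof -
  define A where "A = 1 / sqrt (2 * pi * \<sigma>\<^sup>2)"
  define B where "B = sqrt (2 * pi * (\<sigma> / sqrt \<alpha>)\<^sup>2)"
  have pos: "A > 0" "B > 0"
    using assms(1,2) by (auto simp: A_def B_def)
  have c: "c = A powr \<alpha> * B"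
    by (simp only: c_def A_def B_def)
  show "c > 0"
    using pos by (simp add: c)
  have "gauss_density \<sigma> x powr \<alpha> = (A * exp (- x\<^sup>2 / (2 * \<sigma>\<^sup>2))) powr \<alpha>"
    unfolding A_def normal_density_def by simp
  also have "\<dots> = A powr \<alpha> * exp (- x\<^sup>2 / (2 * \<sigma>\<^sup>2)) powr \<alpha>"
    by (rule powr_mult)
  also have "exp (- x\<^sup>2 / (2 * \<sigma>\<^sup>2)) powr \<alpha> = exp (- x\<^sup>2 / (2 * \<sigma>\<^sup>2) * \<alpha>)"
    by (rule exp_powr_real)
  also have "- x\<^sup>2 / (2 * \<sigma>\<^sup>2) * \<alpha> = - x\<^sup>2 / (2 * (\<sigma> / sqrt \<alpha>)\<^sup>2)"
    using assms(1,2) by (simp add: power_divide)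
  also have "A powr \<alpha> * exp (- x\<^sup>2 / (2 * (\<sigma> / sqrt \<alpha>)\<^sup>2)) =
      c * (1 / B * exp (- x\<^sup>2 / (2 * (\<sigma> / sqrt \<alpha>)\<^sup>2)))"
    using pos(2) by (simp add: c)
  also have "1 / B * exp (- x\<^sup>2 / (2 * (\<sigma> / sqrt \<alpha>)\<^sup>2)) = gauss_density (\<sigma> / sqrt \<alpha>) x"
    unfolding B_def normal_density_def by simp
  finally show "gauss_density \<sigma> x powr \<alpha> = c * gauss_density (\<sigma> / sqrt \<alpha>) x" .
qed

lemma integrable_gauss_density_powr:
  assumes "\<alpha> > 0" "\<sigma> > 0"
  shows "integrable lborel (\<lambda>x. gauss_density \<sigma> x powr \<alpha>)"
  unfolding gauss_density_powr(2)[OF assms]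
  using assms by (intro integrable_mult_right integrable_normal_density) auto

lemma power_integral_gauss_density_pos:
  assumes "\<alpha> > 0" "\<sigma> > 0"
  shows "power_integral \<alpha> (gauss_density \<sigma>) > 0"
proof -
  have "\<sigma> / sqrt \<alpha> > 0"
    using assms by simp
  then have "power_integral \<alpha> (gauss_density \<sigma>) =
      (1 / sqrt (2 * pi * \<sigma>\<^sup>2)) powr \<alpha> * sqrt (2 * pi * (\<sigma> / sqrt \<alpha>)\<^sup>2)"
    unfolding power_integral_def gauss_density_powr(2)[OF assms] integral_mult_right_zero
    by (simp only: integral_normal_density mult_1_right)
  then show ?thesis
    using gauss_density_powr(1)[OF assms] by simp
qed

end

theory Submission
  imports Defs "HOL-Real_Asymp.Real_Asymp"
begin

text \<open>
  A power of a centred Gaussian density is, up to a constant factor, again a centred Gaussian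
  density. The integral of the \<open>\<alpha>\<close>-th power is this factor, and it is proportional to
  \<open>\<sigma>\<close> to the power \<open>1 - \<alpha>\<close>. The critical value \<open>\<sigma>\<^sub>\<alpha>\<close> is the standard deviation at which the
  integral equals \<open>1\<close>, so its logarithm is \<open>(1 - \<alpha>) (log \<sigma> - log \<sigma>\<^sub>\<alpha>)\<close>, which is
  \<open>ln_power_integral_gauss_density\<close>.

  Consequently all three entropies are elementary functions of the single variable
  \<open>t = log \<sigma> - log \<sigma>\<^sub>\<alpha>\<close>, which runs increasingly through the whole real line and changes sign at
  \<open>\<sigma>\<^sub>\<alpha>\<close>. The first entropy is \<open>\<bar>t\<bar>\<close>; the second is the positive part of \<open>t\<close> or of \<open>-t\<close>, according
  to the sign of \<open>1 - \<alpha>\<close>; the third is a positive multiple of \<open>log (exp ((1 - \<alpha>) t) + 1)\<close>, where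
  \<open>u \<mapsto> log (exp u + 1)\<close> increases from \<open>0\<close> to \<open>+\<infinity>\<close> on the real line. The claims on monotonicity
  and limits are properties of these functions of \<open>t\<close>.
\<close>

lemma sigma_crit_pos:
  assumes "\<alpha> > 0"
  shows "sigma_crit \<alpha> > 0"
  using assms by (simp add: sigma_crit_def)

lemma ln_sigma_crit:
  assumes "\<alpha> > 0"
  shows "ln (sigma_crit \<alpha>) = - 1 / 2 * ln (2 * pi) + ln \<alpha> / (2 * (1 - \<alpha>))"
  using assms by (simp add: sigma_crit_def ln_mult ln_powr)

text \<open>
  The integral is the constant relating the power of the density to the Gaussian density with
  standard deviation \<open>\<sigma> / sqrt \<alpha>\<close>, whose total mass is \<open>1\<close>. Its dependence on \<open>\<sigma>\<close> comes from
  \<open>\<sigma> powr (- \<alpha>)\<close> in the power of the normalising factor and \<open>\<sigma>\<close> in the new standard deviation;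
  what remains is absorbed by \<open>sigma_crit \<alpha>\<close>.
\<close>

lemma ln_power_integral_gauss_density:
  assumes "\<alpha> > 0" "\<alpha> \<noteq> 1" "\<sigma> > 0"
  shows "ln (power_integral \<alpha> (gauss_density \<sigma>)) = (1 - \<alpha>) * (ln \<sigma> - ln (sigma_crit \<alpha>))"
proof -
  have "\<sigma> / sqrt \<alpha> > 0"
    using assms by simp
  then have "power_integral \<alpha> (gauss_density \<sigma>) =
      (1 / sqrt (2 * pi * \<sigma>\<^sup>2)) powr \<alpha> * sqrt (2 * pi * (\<sigma> / sqrt \<alpha>)\<^sup>2)"
    unfolding power_integral_def gauss_density_powr(2)[OF assms(1,3)] integral_mult_right_zero
    by (simp only: integral_normal_density mult_1_right)
  also have "ln \<dots> = \<alpha> * ln (1 / sqrt (2 * pi * \<sigma>\<^sup>2)) + ln (sqrt (2 * pi * (\<sigma> / sqrt \<alpha>)\<^sup>2))"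
    using assms by (simp add: ln_mult ln_powr)
  also have "ln (1 / sqrt (2 * pi * \<sigma>\<^sup>2)) = - (1 / 2 * ln (2 * pi) + ln \<sigma>)"
    using assms by (simp add: ln_div ln_sqrt ln_mult ln_realpow field_simps)
  also have "ln (sqrt (2 * pi * (\<sigma> / sqrt \<alpha>)\<^sup>2)) = 1 / 2 * ln (2 * pi) + ln \<sigma> - 1 / 2 * ln \<alpha>"
    using assms by (simp add: ln_div ln_sqrt ln_mult ln_realpow field_simps)
  also have "\<alpha> * - (1 / 2 * ln (2 * pi) + ln \<sigma>) + (1 / 2 * ln (2 * pi) + ln \<sigma> - 1 / 2 * ln \<alpha>)
      = (1 - \<alpha>) * (ln \<sigma> - ln (sigma_crit \<alpha>))"
    using assms by (simp add: ln_sigma_crit divide_simps) (simp add: algebra_simps)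
  finally show ?thesis .
qed

lemma H1_gauss:
  assumes "\<alpha> > 0" "\<alpha> \<noteq> 1" "\<sigma> > 0"
  shows "H1 \<alpha> \<sigma> = \<bar>ln \<sigma> - ln (sigma_crit \<alpha>)\<bar>"
  using assms
  by (simp add: H1_def alt_renyi_entropy1_def ln_power_integral_gauss_density abs_mult)

lemma H2_gauss_less_1:
  assumes "\<alpha> > 0" "\<alpha> < 1" "\<sigma> > 0"
  shows "H2 \<alpha> \<sigma> = max (ln \<sigma> - ln (sigma_crit \<alpha>)) 0"
  using assms
  by (simp add: H2_def alt_renyi_entropy2_def ln_power_integral_gauss_density max_def
      mult_le_0_iff)

lemma H2_gauss_greater_1:
  assumes "\<alpha> > 1" "\<sigma> > 0"
  shows "H2 \<alpha> \<sigma> = max (ln (sigma_crit \<alpha>) - ln \<sigma>) 0"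
proof -
  have "(1 - \<alpha>) * (ln \<sigma> - ln (sigma_crit \<alpha>)) = (\<alpha> - 1) * (ln (sigma_crit \<alpha>) - ln \<sigma>)"
    by (simp add: algebra_simps)
  then show ?thesis
    using assms
    by (simp add: H2_def alt_renyi_entropy2_def ln_power_integral_gauss_density max_def
        mult_le_0_iff)
qed

lemma H3_gauss:
  assumes "\<alpha> > 0" "\<alpha> \<noteq> 1" "\<sigma> > 0"
  shows "H3 \<alpha> \<sigma> = ln (exp ((1 - \<alpha>) * (ln \<sigma> - ln (sigma_crit \<alpha>))) + 1) / \<bar>1 - \<alpha>\<bar>"
  using assms power_integral_gauss_density_pos[of \<alpha> \<sigma>]
  by (simp add: H3_def alt_renyi_entropy3_def flip: ln_power_integral_gauss_density)

text \<open>
  The closed forms of the entropies hold for positive \<open>\<sigma>\<close> only; this suffices to compute limits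
  at the two ends of the positive half-line.
\<close>

lemma filterlim_transfer_positive:
  fixes f g :: "real \<Rightarrow> real"
  assumes eq: "\<And>\<sigma>. \<sigma> > 0 \<Longrightarrow> f \<sigma> = g \<sigma>"
  shows "filterlim g F (at_right 0) \<Longrightarrow> filterlim f F (at_right 0)"
    and "filterlim g F at_top \<Longrightarrow> filterlim f F at_top"
proof -
  have "\<forall>\<^sub>F \<sigma> in at_right 0. f \<sigma> = g \<sigma>"
    using eventually_at_right_less by eventually_elim (rule eq)
  then show "filterlim g F (at_right 0) \<Longrightarrow> filterlim f F (at_right 0)"
    using filterlim_cong[OF refl refl] by blast
  have "\<forall>\<^sub>F \<sigma> in at_top. f \<sigma> = g \<sigma>"
    using eventually_gt_at_top[of 0] by eventually_elim (rule eq)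
  then show "filterlim g F at_top \<Longrightarrow> filterlim f F at_top"
    using filterlim_cong[OF refl refl] by blast
qed

theorem proposition3:
  fixes \<alpha> :: real
  assumes "\<alpha> > 0" and "\<alpha> \<noteq> 1"
  shows
    "((\<forall>\<sigma>>0. H1 \<alpha> \<sigma> =
          (if \<sigma> \<le> sigma_crit \<alpha>
           then - ln \<sigma> - 1 / 2 * ln (2 * pi) + ln \<alpha> / (2 * (1 - \<alpha>))
           else ln \<sigma> + 1 / 2 * ln (2 * pi) - ln \<alpha> / (2 * (1 - \<alpha>)))) \<and>
      strict_antimono_on {0<..sigma_crit \<alpha>} (H1 \<alpha>) \<and>
      filterlim (H1 \<alpha>) at_top (at_right 0) \<and>
      H1 \<alpha> (sigma_crit \<alpha>) = 0 \<and>
      strict_mono_on {sigma_crit \<alpha>..} (H1 \<alpha>) \<and>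
      filterlim (H1 \<alpha>) at_top at_top) \<and>
     (\<alpha> < 1 \<longrightarrow>
      (\<forall>\<sigma>>0. H2 \<alpha> \<sigma> =
          (if \<sigma> \<le> sigma_crit \<alpha>
           then 0
           else ln \<sigma> + 1 / 2 * ln (2 * pi) - ln \<alpha> / (2 * (1 - \<alpha>)))) \<and>
      strict_mono_on {sigma_crit \<alpha>..} (H2 \<alpha>) \<and>
      H2 \<alpha> (sigma_crit \<alpha>) = 0 \<and>
      filterlim (H2 \<alpha>) at_top at_top) \<and>
     (\<alpha> > 1 \<longrightarrow>
      (\<forall>\<sigma>>0. H2 \<alpha> \<sigma> =
          (if \<sigma> \<le> sigma_crit \<alpha>
           then - ln \<sigma> - 1 / 2 * ln (2 * pi) + ln \<alpha> / (2 * (1 - \<alpha>))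
           else 0)) \<and>
      strict_antimono_on {0<..sigma_crit \<alpha>} (H2 \<alpha>) \<and>
      filterlim (H2 \<alpha>) at_top (at_right 0) \<and>
      H2 \<alpha> (sigma_crit \<alpha>) = 0) \<and>
     (\<alpha> < 1 \<longrightarrow>
      strict_mono_on {0<..} (H3 \<alpha>) \<and>
      (H3 \<alpha> \<longlongrightarrow> 0) (at_right 0) \<and>
      filterlim (H3 \<alpha>) at_top at_top) \<and>
     (\<alpha> > 1 \<longrightarrow>
      strict_antimono_on {0<..} (H3 \<alpha>) \<and>
      filterlim (H3 \<alpha>) at_top (at_right 0) \<and>
      (H3 \<alpha> \<longlongrightarrow> 0) at_top)"
proof -
  define s where "s = sigma_crit \<alpha>"
  have s: "s > 0"
    using assms(1) by (simp add: s_def sigma_crit_pos)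
  have ln_s: "ln s = - 1 / 2 * ln (2 * pi) + ln \<alpha> / (2 * (1 - \<alpha>))"
    using assms(1) by (simp add: s_def ln_sigma_crit)

  have H1_eq: "H1 \<alpha> \<sigma> = \<bar>ln \<sigma> - ln s\<bar>" if "\<sigma> > 0" for \<sigma>
    using H1_gauss[OF assms that] by (simp add: s_def)
  have H1_cases: "\<forall>\<sigma>>0. H1 \<alpha> \<sigma> =
      (if \<sigma> \<le> s
       then - ln \<sigma> - 1 / 2 * ln (2 * pi) + ln \<alpha> / (2 * (1 - \<alpha>))
       else ln \<sigma> + 1 / 2 * ln (2 * pi) - ln \<alpha> / (2 * (1 - \<alpha>)))"
  proof (intro allI impI)
    fix \<sigma> :: real
    assume "\<sigma> > 0"
    then have "ln \<sigma> \<le> ln s \<longleftrightarrow> \<sigma> \<le> s"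
      using s by simp
    then show "H1 \<alpha> \<sigma> =
      (if \<sigma> \<le> s
       then - ln \<sigma> - 1 / 2 * ln (2 * pi) + ln \<alpha> / (2 * (1 - \<alpha>))
       else ln \<sigma> + 1 / 2 * ln (2 * pi) - ln \<alpha> / (2 * (1 - \<alpha>)))"
      using H1_eq[OF \<open>\<sigma> > 0\<close>] ln_s by auto
  qed
  have H1_anti: "strict_antimono_on {0<..s} (H1 \<alpha>)"
  proof (rule monotone_onI)
    fix x y :: real
    assume *: "x \<in> {0<..s}" "y \<in> {0<..s}" "x < y"
    then have "ln x < ln y" "ln y \<le> ln s"
      by auto
    then show "H1 \<alpha> x > H1 \<alpha> y"
      using * by (simp add: H1_eq)
  qed
  have H1_mono: "strict_mono_on {s..} (H1 \<alpha>)"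
  proof (rule monotone_onI)
    fix x y :: real
    assume *: "x \<in> {s..}" "y \<in> {s..}" "x < y"
    then have "ln s \<le> ln x" "ln x < ln y" "x > 0" "y > 0"
      using s by auto
    then show "H1 \<alpha> x < H1 \<alpha> y"
      unfolding H1_eq[OF \<open>x > 0\<close>] H1_eq[OF \<open>y > 0\<close>] by linarith
  qed
  have H1_lim_0: "filterlim (H1 \<alpha>) at_top (at_right 0)"
    by (rule filterlim_transfer_positive(1), erule H1_eq) real_asymp
  have H1_lim_top: "filterlim (H1 \<alpha>) at_top at_top"
    by (rule filterlim_transfer_positive(2), erule H1_eq) real_asymp
  have H1_s: "H1 \<alpha> s = 0"
    using s by (simp add: H1_eq)

  \<comment> \<open>Taking the positive part keeps one of the two branches of the absolute value and cuts the other
    one to \<open>0\<close>; on the branch that is kept, all properties are inherited from \<open>H1\<close>.\<close>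
  have H2_less: "(\<forall>\<sigma>>0. H2 \<alpha> \<sigma> =
          (if \<sigma> \<le> s then 0
           else ln \<sigma> + 1 / 2 * ln (2 * pi) - ln \<alpha> / (2 * (1 - \<alpha>)))) \<and>
      strict_mono_on {s..} (H2 \<alpha>) \<and> H2 \<alpha> s = 0 \<and> filterlim (H2 \<alpha>) at_top at_top"
    if "\<alpha> < 1"
  proof -
    have H2_eq: "H2 \<alpha> \<sigma> = (if \<sigma> \<le> s then 0 else H1 \<alpha> \<sigma>)" if "\<sigma> > 0" for \<sigma>
      using H2_gauss_less_1[OF assms(1) \<open>\<alpha> < 1\<close> that] H1_eq[OF that] that s
      by (auto simp: s_def max_def not_le)
    have agree: "H2 \<alpha> \<sigma> = H1 \<alpha> \<sigma>" if "\<sigma> \<ge> s" for \<sigma>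
      using that s H1_s by (auto simp: H2_eq)
    have "strict_mono_on {s..} (H2 \<alpha>)"
      using H1_mono agree by (simp add: monotone_on_def)
    moreover have "filterlim (H2 \<alpha>) at_top at_top"
      using H1_lim_top
      by (rule filterlim_mono_eventually)
        (auto intro: eventually_mono[OF eventually_ge_at_top[of s]] simp: agree)
    ultimately show ?thesis
      using H2_eq H1_cases H1_s s agree by auto
  qed

  have H2_greater: "(\<forall>\<sigma>>0. H2 \<alpha> \<sigma> =
          (if \<sigma> \<le> s then - ln \<sigma> - 1 / 2 * ln (2 * pi) + ln \<alpha> / (2 * (1 - \<alpha>))
           else 0)) \<and>
      strict_antimono_on {0<..s} (H2 \<alpha>) \<and> filterlim (H2 \<alpha>) at_top (at_right 0) \<and> H2 \<alpha> s = 0"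
    if "\<alpha> > 1"
  proof -
    have H2_eq: "H2 \<alpha> \<sigma> = (if \<sigma> \<le> s then H1 \<alpha> \<sigma> else 0)" if "\<sigma> > 0" for \<sigma>
      using H2_gauss_greater_1[OF \<open>\<alpha> > 1\<close> that] H1_eq[OF that] that s
      by (auto simp: s_def max_def not_le)
    have "strict_antimono_on {0<..s} (H2 \<alpha>)"
      using H1_anti H2_eq by (simp add: monotone_on_def)
    moreover have "\<forall>\<^sub>F \<sigma> in at_right 0. H1 \<alpha> \<sigma> = H2 \<alpha> \<sigma>"
      using eventually_at_right_real[OF s] by eventually_elim (simp add: H2_eq)
    then have "filterlim (H2 \<alpha>) at_top (at_right 0)"
      using H1_lim_0 filterlim_cong[OF refl refl] by metis
    ultimately show ?thesis
      using H2_eq H1_cases H1_s s by auto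
  qed

  have H3_eq: "H3 \<alpha> \<sigma> = ln (exp ((1 - \<alpha>) * (ln \<sigma> - ln s)) + 1) / \<bar>1 - \<alpha>\<bar>"
    if "\<sigma> > 0" for \<sigma>
    using H3_gauss[OF assms that] by (simp add: s_def)
  have H3_less_iff: "H3 \<alpha> x < H3 \<alpha> y \<longleftrightarrow> (1 - \<alpha>) * ln x < (1 - \<alpha>) * ln y"
    if "x > 0" "y > 0" for x y
    using assms(2) that by (simp add: H3_eq divide_less_cancel add_pos_pos right_diff_distrib)
  \<comment> \<open>The sign of \<open>1 - \<alpha>\<close> only decides which end of the half-line is sent to which end of the real
    line, so both cases of the third entropy use the same two limits.\<close>
  have softplus_0: "((\<lambda>u::real. ln (exp u + 1) / \<bar>1 - \<alpha>\<bar>) \<longlongrightarrow> 0) at_bot"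
    by (rule tendsto_divide_zero) real_asymp
  have softplus_top: "filterlim (\<lambda>u::real. ln (exp u + 1) / \<bar>1 - \<alpha>\<bar>) at_top at_top"
  proof -
    have "filterlim (\<lambda>u::real. ln (exp u + 1) / c) at_top at_top" if "c > 0" for c :: real
      using that by real_asymp
    then show ?thesis
      using assms(2) by simp
  qed

  have H3_less: "strict_mono_on {0<..} (H3 \<alpha>) \<and> (H3 \<alpha> \<longlongrightarrow> 0) (at_right 0) \<and>
      filterlim (H3 \<alpha>) at_top at_top" if "\<alpha> < 1"
  proof (intro conjI)
    show "strict_mono_on {0<..} (H3 \<alpha>)"
      using that by (intro monotone_onI) (simp add: H3_less_iff)
    have "filterlim (\<lambda>\<sigma>. (1 - \<alpha>) * (ln \<sigma> - ln s)) at_bot (at_right 0)"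
      using that by real_asymp
    then show "(H3 \<alpha> \<longlongrightarrow> 0) (at_right 0)"
      by (intro filterlim_transfer_positive(1)[OF H3_eq] filterlim_compose[OF softplus_0])
    have "filterlim (\<lambda>\<sigma>. (1 - \<alpha>) * (ln \<sigma> - ln s)) at_top at_top"
      using that by real_asymp
    then show "filterlim (H3 \<alpha>) at_top at_top"
      by (intro filterlim_transfer_positive(2)[OF H3_eq] filterlim_compose[OF softplus_top])
  qed

  have H3_greater: "strict_antimono_on {0<..} (H3 \<alpha>) \<and> filterlim (H3 \<alpha>) at_top (at_right 0) \<and>
      (H3 \<alpha> \<longlongrightarrow> 0) at_top" if "\<alpha> > 1"
  proof (intro conjI)
    show "strict_antimono_on {0<..} (H3 \<alpha>)"
      using that by (intro monotone_onI) (simp add: H3_less_iff)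
    have "filterlim (\<lambda>\<sigma>. (1 - \<alpha>) * (ln \<sigma> - ln s)) at_top (at_right 0)"
      using that by real_asymp
    then show "filterlim (H3 \<alpha>) at_top (at_right 0)"
      by (intro filterlim_transfer_positive(1)[OF H3_eq] filterlim_compose[OF softplus_top])
    have "filterlim (\<lambda>\<sigma>. (1 - \<alpha>) * (ln \<sigma> - ln s)) at_bot at_top"
      using that by real_asymp
    then show "(H3 \<alpha> \<longlongrightarrow> 0) at_top"
      by (intro filterlim_transfer_positive(2)[OF H3_eq] filterlim_compose[OF softplus_0])
  qed

  show ?thesis
    using H1_cases H1_anti H1_lim_0 H1_s H1_mono H1_lim_top H2_less H2_greater H3_less H3_greater
    unfolding s_def by blast
qed

end
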